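(* Let $n,m\in\mathbb{N}$, let $A=M_n(\mathbb{C})$, let $\mathfrak{g}\subseteq \mathrm{Der}(A)$ be a (complex) Lie subalgebra, let $\mathcal{E}=M_{m,n}(\mathbb{C})$ regarded as a right $A$-module by matrix multiplication from the right, and let $\nabla$ be a connection on $\mathcal{E}$ (with respect to $\mathfrak{g}$). Then for every $X\in\mathfrak{g}$ there exists a unique module parallel transport $\Phi^{\nabla_X}:\mathbb{R}\times\mathcal{E}\to\mathcal{E}$, $(\tau,s)\mapsto\Phi^{\nabla_X}_\tau(s)$, along the one-parameter group of automorphisms $\varphi^X$ generated by $X$, which satisfies the ordinary differential equation $$\frac{d}{d\tau}\Phi^{\nabla_X}_\tau=\nabla_X\circ\Phi^{\nabla_X}_\tau .$$ It is given, for all $X\in\mathfrak{g}$, $s\in\mathcal{E}$ and $\tau\in\mathbb{R}$, by $$\Phi^{\nabla_X}_\tau(s)=e^{\tau B(X)}\,s\,e^{-\tau\theta(X)},$$ where $B:\mathfrak{g}\to M_m(\mathbb{C})$ is the gauge potential of $\nabla$ relative to the canonical connection $\nabla^\theta$.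
   Context: $M_{m,n}(\mathbb{C})$ is the space of complex $m\times n$-matrices and $\mathrm{Der}(A)$ is the complex Lie algebra (under commutator) of $\mathbb{C}$-linear derivations of $A=M_n(\mathbb{C})$. Every derivation of $A$ is inner: $\gamma\mapsto[\gamma,\cdot\,]$ is a Lie algebra isomorphism from the traceless matrices $\mathfrak{sl}_n$ onto $\mathrm{Der}(A)$. Its inverse is denoted $\theta:\mathrm{Der}(A)\to\mathfrak{sl}_n\subset A$, so $\theta(X)$ is the unique traceless matrix with $X(a)=[\theta(X),a]$ for all $a\in A$. A connection on $\mathcal{E}$ is a $\mathbb{C}$-linear map $\nabla:\mathcal{E}\to\mathcal{E}\otimes_{\mathbb{C}}\mathfrak{g}^\ast$ satisfying the Leibniz rule $\nabla(s\,a)=(\nabla s)\,a+s\,\mathrm{d}a$ with $(\mathrm{d}a)(X)=X(a)$. Equivalently, it is a family of $\mathbb{C}$-linear maps $\nabla_X:\mathcal{E}\to\mathcal{E}$, $\nabla_Xs=(\nabla s)(X)$, depending $\mathbb{C}$-linearly on $X\in\mathfrak{g}$, with $\nabla_X(s\,a)=(\nabla_Xs)\,a+s\,X(a)$ for all $s\in\mathcal{E}$, $a\in A$. The canonical connection is $\nabla^\theta_Xs=-s\,\theta(X)$. Every connection can be written uniquely as $\nabla_Xs=-s\,\theta(X)+B(X)\,s$ with a $\mathbb{C}$-linear map $B:\mathfrak{g}\to M_m(\mathbb{C})$, i.e. $B\in M_m(\mathbb{C})\otimes_{\mathbb{C}}\mathfrak{g}^\ast$; $B$ is called the gauge potential of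 $\nabla$ relative to $\nabla^\theta$. A one-parameter group of automorphisms of $A$ is a smooth map $\varphi:\mathbb{R}\times A\to A$, $(\tau,a)\mapsto\varphi_\tau(a)$, with $\varphi_\tau(ab)=\varphi_\tau(a)\varphi_\tau(b)$, $\varphi_0=\mathrm{id}_A$ and $\varphi_{\tau+\sigma}=\varphi_\tau\circ\varphi_\sigma$. The one generated by $X\in\mathrm{Der}(A)$ is $\varphi^X_\tau=e^{\tau X}$, i.e. $\varphi^X_\tau(a)=e^{\tau\theta(X)}\,a\,e^{-\tau\theta(X)}$. A module parallel transport on $\mathcal{E}$ along $\varphi$ is a smooth map $\Phi:\mathbb{R}\times\mathcal{E}\to\mathcal{E}$, $(\tau,s)\mapsto\Phi_\tau(s)$, such that for all $\tau,\sigma\in\mathbb{R}$, $s\in\mathcal{E}$, $a\in A$: (i) $\Phi_\tau(s\,a)=\Phi_\tau(s)\,\varphi_\tau(a)$; (ii) $\Phi_0=\mathrm{id}_{\mathcal{E}}$; (iii) $\Phi_{\tau+\sigma}=\Phi_\tau\circ\Phi_\sigma$. *)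

theory Defs
  imports "HOL-Analysis.Analysis"
begin

text \<open>
  Complex \<open>m \<times> n\<close>-matrices are elements of \<^typ>\<open>complex ^ 'n ^ 'm\<close>; the algebra \<open>A\<close> is
  \<^typ>\<open>complex ^ 'n ^ 'n\<close> with product \<open>**\<close> (the library's \<open>*\<close> on vectors is componentwise),
  and the right \<open>A\<close>-module structure of \<open>E\<close> is again \<open>**\<close>.  The dimensions are the
  cardinalities of the index types, hence positive.
\<close>

definition cscale :: "complex \<Rightarrow> complex ^ 'n ^ 'm \<Rightarrow> complex ^ 'n ^ 'm"  (infixr "*\<^sub>c" 75)
  where "c *\<^sub>c M = map_matrix ((*) c) M"

lemma vector_space_cscale: "vector_space (cscale :: complex \<Rightarrow> complex ^ 'n ^ 'm \<Rightarrow> _)"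
  by unfold_locales (auto simp: cscale_def vec_eq_iff algebra_simps)

abbreviation clinear :: "(complex ^ 'n ^ 'm \<Rightarrow> complex ^ 'l ^ 'k) \<Rightarrow> bool"
  where "clinear \<equiv> Vector_Spaces.linear cscale cscale"

definition Der :: "(complex ^ 'n ^ 'n \<Rightarrow> complex ^ 'n ^ 'n) set"
  where "Der = {X. clinear X \<and> (\<forall>a b. X (a ** b) = X a ** b + a ** X b)}"

definition lie_subalgebra_Der :: "(complex ^ 'n ^ 'n \<Rightarrow> complex ^ 'n ^ 'n) set \<Rightarrow> bool"
  where "lie_subalgebra_Der \<gg> \<longleftrightarrow>
    \<gg> \<subseteq> Der \<and>
    (\<lambda>a. 0) \<in> \<gg> \<and>
    (\<forall>X\<in>\<gg>. \<forall>Y\<in>\<gg>. (\<lambda>a. X a + Y a) \<in> \<gg>) \<and>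
    (\<forall>c. \<forall>X\<in>\<gg>. (\<lambda>a. c *\<^sub>c X a) \<in> \<gg>) \<and>
    (\<forall>X\<in>\<gg>. \<forall>Y\<in>\<gg>. (\<lambda>a. X (Y a) - Y (X a)) \<in> \<gg>)"

definition theta :: "(complex ^ 'n ^ 'n \<Rightarrow> complex ^ 'n ^ 'n) \<Rightarrow> complex ^ 'n ^ 'n"
  where "theta X = (THE \<gamma>. trace \<gamma> = 0 \<and> (\<forall>a. X a = \<gamma> ** a - a ** \<gamma>))"

text \<open>\<open>\<complex>\<close>-linearity on the subspace \<open>\<gg>\<close> of derivations (values off \<open>\<gg>\<close> are irrelevant).\<close>

definition clinear_on_Der ::
    "(complex ^ 'n ^ 'n \<Rightarrow> complex ^ 'n ^ 'n) set \<Rightarrow>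
     ((complex ^ 'n ^ 'n \<Rightarrow> complex ^ 'n ^ 'n) \<Rightarrow> complex ^ 'l ^ 'k) \<Rightarrow> bool"
  where "clinear_on_Der \<gg> f \<longleftrightarrow>
    (\<forall>X\<in>\<gg>. \<forall>Y\<in>\<gg>. f (\<lambda>a. X a + Y a) = f X + f Y) \<and>
    (\<forall>c. \<forall>X\<in>\<gg>. f (\<lambda>a. c *\<^sub>c X a) = c *\<^sub>c f X)"

text \<open>
  A map \<open>E \<rightarrow> E \<otimes> \<gg>\<^sup>*\<close> is given as the family \<open>D X s = (D s)(X)\<close>,
  linear both in \<open>s\<close> and in \<open>X \<in> \<gg>\<close>.
\<close>

definition connection ::
    "(complex ^ 'n ^ 'n \<Rightarrow> complex ^ 'n ^ 'n) set \<Rightarrow>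
     ((complex ^ 'n ^ 'n \<Rightarrow> complex ^ 'n ^ 'n) \<Rightarrow> complex ^ 'n ^ 'm \<Rightarrow> complex ^ 'n ^ 'm) \<Rightarrow> bool"
  where "connection \<gg> D \<longleftrightarrow>
    (\<forall>X\<in>\<gg>. clinear (D X)) \<and>
    (\<forall>s. clinear_on_Der \<gg> (\<lambda>X. D X s)) \<and>
    (\<forall>X\<in>\<gg>. \<forall>s a. D X (s ** a) = D X s ** a + s ** X a)"

definition canonical_connection ::
    "(complex ^ 'n ^ 'n \<Rightarrow> complex ^ 'n ^ 'n) \<Rightarrow> complex ^ 'n ^ 'm \<Rightarrow> complex ^ 'n ^ 'm"
  where "canonical_connection X s = - (s ** theta X)"

text \<open>Extensionality makes a map with domain \<open>\<gg>\<close> a unique HOL function.\<close>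

definition gauge_potential ::
    "(complex ^ 'n ^ 'n \<Rightarrow> complex ^ 'n ^ 'n) set \<Rightarrow>
     ((complex ^ 'n ^ 'n \<Rightarrow> complex ^ 'n ^ 'n) \<Rightarrow> complex ^ 'n ^ 'm \<Rightarrow> complex ^ 'n ^ 'm) \<Rightarrow>
     (complex ^ 'n ^ 'n \<Rightarrow> complex ^ 'n ^ 'n) \<Rightarrow> complex ^ 'm ^ 'm"
  where "gauge_potential \<gg> D = (THE B. B \<in> extensional \<gg> \<and> clinear_on_Der \<gg> B \<and>
    (\<forall>X\<in>\<gg>. \<forall>s. D X s = canonical_connection X s + B X ** s))"

text \<open>
  Exponential series, of a square matrix and (evaluated pointwise) of an endomorphism of a
  finite-dimensional space.  The library's \<^const>\<open>exp\<close> is not available on these types.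
\<close>

definition mexp :: "complex ^ 'k ^ 'k \<Rightarrow> complex ^ 'k ^ 'k"
  where "mexp M = (\<Sum>k. (((**) M ^^ k) (mat 1)) /\<^sub>R fact k)"

definition opexp :: "('v::real_normed_vector \<Rightarrow> 'v) \<Rightarrow> 'v \<Rightarrow> 'v"
  where "opexp T v = (\<Sum>k. ((T ^^ k) v) /\<^sub>R fact k)"

definition flow ::
    "(complex ^ 'n ^ 'n \<Rightarrow> complex ^ 'n ^ 'n) \<Rightarrow> real \<Rightarrow> complex ^ 'n ^ 'n \<Rightarrow> complex ^ 'n ^ 'n"
  where "flow X \<tau> = opexp (\<lambda>a. \<tau> *\<^sub>R X a)"

text \<open>
  \<open>C_diff k f\<close>: all iterated directional derivatives of \<open>f\<close> up to order \<open>k\<close> exist as values of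
  Frechet derivatives and are continuous.  In finite dimensions this is the class \<open>C\<^sup>k\<close>
  of real differentiability.
\<close>

fun C_diff :: "nat \<Rightarrow> ('a::real_normed_vector \<Rightarrow> 'b::real_normed_vector) \<Rightarrow> bool"
  where
    "C_diff 0 f \<longleftrightarrow> continuous_on UNIV f"
  | "C_diff (Suc k) f \<longleftrightarrow>
      (\<exists>f'. (\<forall>x. (f has_derivative f' x) (at x)) \<and> (\<forall>v. C_diff k (\<lambda>x. f' x v)))"

definition smooth :: "('a::real_normed_vector \<Rightarrow> 'b::real_normed_vector) \<Rightarrow> bool"
  where "smooth f \<longleftrightarrow> (\<forall>k. C_diff k f)"

definition one_parameter_group :: "(real \<Rightarrow> complex ^ 'n ^ 'n \<Rightarrow> complex ^ 'n ^ 'n) \<Rightarrow> bool"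
  where "one_parameter_group \<phi> \<longleftrightarrow>
    smooth (\<lambda>(\<tau>, a). \<phi> \<tau> a) \<and>
    (\<forall>\<tau> a b. \<phi> \<tau> (a ** b) = \<phi> \<tau> a ** \<phi> \<tau> b) \<and>
    \<phi> 0 = id \<and>
    (\<forall>\<tau> \<sigma>. \<phi> (\<tau> + \<sigma>) = \<phi> \<tau> \<circ> \<phi> \<sigma>)"

definition module_parallel_transport ::
    "(real \<Rightarrow> complex ^ 'n ^ 'n \<Rightarrow> complex ^ 'n ^ 'n) \<Rightarrow>
     (real \<Rightarrow> complex ^ 'n ^ 'm \<Rightarrow> complex ^ 'n ^ 'm) \<Rightarrow> bool"
  where "module_parallel_transport \<phi> \<Phi> \<longleftrightarrow>
    one_parameter_group \<phi> \<and>
    smooth (\<lambda>(\<tau>, s). \<Phi> \<tau> s) \<and>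
    (\<forall>\<tau> s a. \<Phi> \<tau> (s ** a) = \<Phi> \<tau> s ** \<phi> \<tau> a) \<and>
    \<Phi> 0 = id \<and>
    (\<forall>\<tau> \<sigma>. \<Phi> (\<tau> + \<sigma>) = \<Phi> \<tau> \<circ> \<Phi> \<sigma>)"

definition parallel_transport_of ::
    "((complex ^ 'n ^ 'n \<Rightarrow> complex ^ 'n ^ 'n) \<Rightarrow> complex ^ 'n ^ 'm \<Rightarrow> complex ^ 'n ^ 'm) \<Rightarrow>
     (complex ^ 'n ^ 'n \<Rightarrow> complex ^ 'n ^ 'n) \<Rightarrow>
     (real \<Rightarrow> complex ^ 'n ^ 'm \<Rightarrow> complex ^ 'n ^ 'm) \<Rightarrow> bool"
  where "parallel_transport_of D X \<Phi> \<longleftrightarrow>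
    module_parallel_transport (flow X) \<Phi> \<and>
    (\<forall>\<tau> s. ((\<lambda>t. \<Phi> t s) has_vector_derivative D X (\<Phi> \<tau> s)) (at \<tau>))"

end

theory Submission
  imports Defs
begin

text \<open>
  Both sides of every identity needed of \<open>\<Phi>\<close> (group law, compatibility with the module
  structure, linearity, closed formula) solve the same linear equation \<open>\<Phi>' = \<nabla>\<^sub>X \<Phi>\<close> with the same
  initial value, so all of them follow from uniqueness of solutions.  Joint smoothness holds
  because \<open>\<Phi>\<^sub>\<tau>(s)\<close> is linear in \<open>s\<close>, so that its directional derivatives are again built from
  \<open>\<Phi>\<close> and \<open>\<nabla>\<^sub>X\<close>.

  That derivations are inner and that \<open>\<nabla> - \<nabla>\<^sup>\<theta>\<close> is left multiplication by a matrix are both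
  seen by evaluating on matrices supported in a single column, which identifies that column
  with a vector on which \<open>A\<close> acts from the left.
\<close>

section \<open>Flows of linear vector fields\<close>

lemma C_diff_add:
  assumes "C_diff k f" "C_diff k g"
  shows "C_diff k (\<lambda>x. f x + g x)"
  using assms
proof (induction k arbitrary: f g)
  case 0
  then show ?case by (simp add: continuous_on_add)
next
  case (Suc k)
  then obtain f' g' where
    "\<And>x. (f has_derivative f' x) (at x)" "\<And>v. C_diff k (\<lambda>x. f' x v)"
    "\<And>x. (g has_derivative g' x) (at x)" "\<And>v. C_diff k (\<lambda>x. g' x v)"
    by auto
  with Suc.IH show ?case
    by (auto intro!: exI[of _ "\<lambda>x v. f' x v + g' x v"] has_derivative_add)
qed

text \<open>Differentiation commutes with a fixed bounded linear map, so each directional derivative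
  is again \<open>L\<close> after a map of one class lower and the induction closes.\<close>

lemma C_diff_bounded_linear:
  assumes L: "bounded_linear L" and "C_diff k f"
  shows "C_diff k (\<lambda>x. L (f x))"
  using assms(2)
proof (induction k arbitrary: f)
  case 0
  then show ?case by (simp add: bounded_linear.continuous_on[OF L])
next
  case (Suc k)
  then obtain f' where
    "\<And>x. (f has_derivative f' x) (at x)" "\<And>v. C_diff k (\<lambda>x. f' x v)"
    by auto
  with Suc.IH show ?case
    by (auto intro!: exI[of _ "\<lambda>x v. L (f' x v)"] bounded_linear.has_derivative[OF L])
qed

text \<open>Gronwall's argument: \<open>(f t \<bullet> f t) * exp (- (2 * K * t))\<close> is nonincreasing.\<close>

lemma linear_ode_zero_nonneg:
  fixes f :: "real \<Rightarrow> 'v::real_inner"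
  assumes L: "bounded_linear L"
    and f: "\<And>t. (f has_vector_derivative L (f t)) (at t)"
    and "f 0 = 0" "0 \<le> t"
  shows "f t = 0"
proof -
  obtain K where K: "\<And>x. norm (L x) \<le> norm x * K"
    using bounded_linear.bounded[OF L] by blast
  define h where "h = (\<lambda>t. (f t \<bullet> f t) * exp (- (2 * K * t)))"
  have dh: "(h has_real_derivative (2 * (f x \<bullet> L (f x)) - 2 * K * (f x \<bullet> f x)) * exp (- (2 * K * x))) (at x)" for x
  proof -
    have "((\<lambda>t. f t \<bullet> f t) has_real_derivative (2 * (f x \<bullet> L (f x)))) (at x)"
      unfolding has_real_derivative_iff_has_vector_derivative has_vector_derivative_def
      by (rule has_derivative_eq_rhs[OF has_derivative_inner])
        (use f[unfolded has_vector_derivative_def] in \<open>auto simp: inner_commute algebra_simps\<close>)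
    then show ?thesis
      unfolding h_def by (auto intro!: derivative_eq_intros simp: algebra_simps)
  qed
  have "h t \<le> h 0"
  proof (rule DERIV_nonpos_imp_nonincreasing[OF assms(4)])
    fix x
    have "f x \<bullet> L (f x) \<le> norm (f x) * norm (L (f x))"
      by (rule norm_cauchy_schwarz)
    also have "\<dots> \<le> norm (f x) * (norm (f x) * K)"
      by (intro mult_left_mono K) auto
    also have "\<dots> = K * (f x \<bullet> f x)"
      by (simp add: dot_square_norm power2_eq_square)
    finally have "(2 * (f x \<bullet> L (f x)) - 2 * K * (f x \<bullet> f x)) * exp (- (2 * K * x)) \<le> 0"
      by (intro mult_nonpos_nonneg) auto
    with dh show "\<exists>y. (h has_real_derivative y) (at x) \<and> y \<le> 0" by blast
  qed
  then have "f t \<bullet> f t \<le> 0"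
    using \<open>f 0 = 0\<close> by (simp add: h_def mult_le_0_iff)
  then show ?thesis by (metis inner_ge_zero inner_eq_zero_iff antisym)
qed

lemma linear_ode_zero:
  fixes f :: "real \<Rightarrow> 'v::real_inner"
  assumes L: "bounded_linear L"
    and f: "\<And>t. (f has_vector_derivative L (f t)) (at t)"
    and "f 0 = 0"
  shows "f t = 0"
proof (cases "0 \<le> t")
  case True
  then show ?thesis using linear_ode_zero_nonneg assms by blast
next
  case False
  \<comment> \<open>Time reversal: the reversed curve solves the equation with \<open>- L\<close>,
    which moves negative times to positive ones.\<close>
  have "((\<lambda>t. f (- t)) has_vector_derivative - L (f (- x))) (at x)" for x
    using vector_diff_chain_at[of uminus "-1" x f "L (f (- x))"] f[of "- x"]
      has_vector_derivative_minus[OF has_vector_derivative_id, of "at x"]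
    by (simp add: o_def)
  from linear_ode_zero_nonneg[OF bounded_linear_minus[OF L] this, of "- t"]
  show ?thesis using False \<open>f 0 = 0\<close> by simp
qed

lemma linear_ode_unique:
  fixes f g :: "real \<Rightarrow> 'v::real_inner"
  assumes L: "bounded_linear L"
    and f: "\<And>t. (f has_vector_derivative L (f t)) (at t)"
    and g: "\<And>t. (g has_vector_derivative L (g t)) (at t)"
    and "f 0 = g 0"
  shows "f t = g t"
proof -
  have "((\<lambda>t. f t - g t) has_vector_derivative L (f x - g x)) (at x)" for x
    using has_vector_derivative_diff[OF f g, of x]
    by (simp add: linear_diff[OF bounded_linear.linear[OF L]])
  from linear_ode_zero[OF L this, of t] show ?thesis using \<open>f 0 = g 0\<close> by simp
qed

section \<open>The exponential series of a bounded operator\<close>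

lemma norm_funpow_le:
  fixes T :: "'v::real_normed_vector \<Rightarrow> 'v"
  assumes "\<And>x. norm (T x) \<le> norm x * K" "0 \<le> K"
  shows "norm ((T ^^ k) v) \<le> norm v * K ^ k"
proof (induction k)
  case (Suc k)
  have "norm ((T ^^ Suc k) v) \<le> norm ((T ^^ k) v) * K"
    using assms(1) by simp
  also have "\<dots> \<le> norm v * K ^ k * K"
    by (rule mult_right_mono[OF Suc assms(2)])
  finally show ?case by (simp add: mult_ac)
qed simp

lemma funpow_scaleR_linear:
  fixes T :: "'v::real_vector \<Rightarrow> 'v"
  assumes "linear T"
  shows "((\<lambda>x. t *\<^sub>R T x) ^^ k) v = t ^ k *\<^sub>R (T ^^ k) v"
  by (induction k) (simp_all add: linear_scale[OF assms])

text \<open>The series is dominated by \<open>norm v\<close> times the real exponential series at a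
  bound \<open>K\<close> for \<open>T\<close>.\<close>

lemma summable_opexp:
  fixes T :: "'v::banach \<Rightarrow> 'v"
  assumes "bounded_linear T"
  shows "summable (\<lambda>k. ((T ^^ k) v) /\<^sub>R fact k)"
proof -
  obtain K where K: "\<And>x. norm (T x) \<le> norm x * K" "0 \<le> K"
    using bounded_linear.nonneg_bounded[OF assms] by blast
  show ?thesis
  proof (rule summable_comparison_test')
    show "summable (\<lambda>k. norm v * (inverse (fact k) * K ^ k))"
      by (intro summable_mult summable_exp)
    show "norm (((T ^^ k) v) /\<^sub>R fact k) \<le> norm v * (inverse (fact k) * K ^ k)" for k
      using norm_funpow_le[of T K k v, OF K]
      by (simp add: field_simps)
  qed
qed

text \<open>Each coordinate is a real power series in \<open>t\<close> converging everywhere, hence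
  differentiable term by term; in a Euclidean space differentiability can be checked on
  coordinates.\<close>

lemma opexp_has_vector_derivative:
  fixes T :: "'v::euclidean_space \<Rightarrow> 'v"
  assumes T: "bounded_linear T"
  shows "((\<lambda>t. opexp (\<lambda>x. t *\<^sub>R T x) v) has_vector_derivative T (opexp (\<lambda>x. t *\<^sub>R T x) v)) (at t)"
proof -
  have sm: "summable (\<lambda>k. (t ^ k / fact k) *\<^sub>R (T ^^ k) v)" for t v
    using summable_opexp[OF bounded_linear_const_scaleR[OF T], of t v]
    by (simp add: funpow_scaleR_linear[OF bounded_linear.linear[OF T]] field_simps)
  have E: "opexp (\<lambda>x. t *\<^sub>R T x) v = (\<Sum>k. (t ^ k / fact k) *\<^sub>R (T ^^ k) v)" for t v
    by (simp add: opexp_def funpow_scaleR_linear[OF bounded_linear.linear[OF T]] field_simps)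
  have "((\<lambda>t. opexp (\<lambda>x. t *\<^sub>R T x) v \<bullet> b) has_real_derivative T (opexp (\<lambda>x. t *\<^sub>R T x) v) \<bullet> b) (at t)"
    for b
  proof -
    define c where "c k = ((T ^^ k) v \<bullet> b) / fact k" for k
    have b: "bounded_linear (\<lambda>x. x \<bullet> b)" by (rule bounded_linear_inner_left)
    have series: "opexp (\<lambda>x. t *\<^sub>R T x) v \<bullet> b = (\<Sum>k. c k * t ^ k)" for t
      unfolding E bounded_linear.suminf[OF b sm] c_def by (simp add: field_simps)
    have "summable (\<lambda>k. c k * y ^ k)" for y
      using bounded_linear.summable[OF b sm, of y v] by (simp add: c_def field_simps)
    then have "((\<lambda>t. \<Sum>k. c k * t ^ k) has_real_derivative (\<Sum>k. diffs c k * t ^ k)) (at t)"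
      by (rule termdiffs_strong_converges_everywhere)
    \<comment> \<open>\<open>diffs c k\<close> is \<open>(k + 1) * c (k + 1)\<close>; the factor
      cancels against \<open>fact (k + 1)\<close> and leaves one extra application of
      \<open>T\<close> in the \<open>k\<close>-th term.\<close>
    moreover have "T (opexp (\<lambda>x. t *\<^sub>R T x) v) \<bullet> b = (\<Sum>k. diffs c k * t ^ k)"
      unfolding E bounded_linear.suminf[OF bounded_linear_compose[OF b T] sm]
      by (simp add: diffs_def c_def linear_scale[OF bounded_linear.linear[OF T]] field_simps
          del: of_nat_Suc)
    ultimately show ?thesis by (simp add: series)
  qed
  then show ?thesis
    unfolding has_vector_derivative_def has_field_derivative_def
    by (subst has_derivative_componentwise_within) (simp add: mult_commute_abs)
qed

lemma opexp_zero: "opexp (\<lambda>x. 0) v = v"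
proof -
  have "(\<lambda>k. (((\<lambda>x. 0) ^^ k) v) /\<^sub>R fact k) = (\<lambda>k. if k = 0 then v else 0)"
  proof
    fix k
    show "(((\<lambda>x. 0) ^^ k) v) /\<^sub>R fact k = (if k = 0 then v else 0)"
      by (cases k) simp_all
  qed
  then show ?thesis
    unfolding opexp_def using suminf_finite[of "{0}" "\<lambda>k. if k = 0 then v else 0"] by simp
qed

text \<open>The equation and the initial values are assumed; linearity, group law and smoothness are
  consequences. The instances are the flow of a derivation on \<open>A\<close> and the exponential
  formula on the module.\<close>

locale linear_flow =
  fixes L :: "'v::euclidean_space \<Rightarrow> 'v" and \<Phi> :: "real \<Rightarrow> 'v \<Rightarrow> 'v"
  assumes bounded_linear: "bounded_linear L"
    and deriv: "\<And>\<tau> s. ((\<lambda>t. \<Phi> t s) has_vector_derivative L (\<Phi> \<tau> s)) (at \<tau>)"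
    and at_0: "\<Phi> 0 s = s"
begin

lemma unique:
  assumes "\<And>t. (f has_vector_derivative L (f t)) (at t)"
  shows "f t = \<Phi> t (f 0)"
  by (rule linear_ode_unique[OF bounded_linear assms deriv]) (simp add: at_0)

lemma linear: "linear (\<Phi> t)"
proof (rule linearI)
  fix x y and c :: real
  note lin = bounded_linear.linear[OF bounded_linear]
  have "((\<lambda>t. \<Phi> t x + \<Phi> t y) has_vector_derivative L (\<Phi> t x + \<Phi> t y)) (at t)" for t
    using has_vector_derivative_add[OF deriv deriv] by (simp add: linear_add[OF lin])
  from unique[OF this, of t] show "\<Phi> t (x + y) = \<Phi> t x + \<Phi> t y" by (simp add: at_0)
  have "((\<lambda>t. c *\<^sub>R \<Phi> t x) has_vector_derivative L (c *\<^sub>R \<Phi> t x)) (at t)" for t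
    using has_vector_derivative_scaleR[OF DERIV_const deriv, of c] by (simp add: linear_scale[OF lin])
  from unique[OF this, of t] show "\<Phi> t (c *\<^sub>R x) = c *\<^sub>R \<Phi> t x" by (simp add: at_0)
qed

text \<open>The equation is autonomous, so the curve shifted by \<open>\<sigma>\<close> solves it
  again, now starting at \<open>\<Phi> \<sigma> s\<close>.\<close>

lemma group_law: "\<Phi> (\<tau> + \<sigma>) = \<Phi> \<tau> \<circ> \<Phi> \<sigma>"
proof
  fix s
  have "((\<lambda>t. t + \<sigma>) has_vector_derivative 1) (at t)" for t
    by (auto intro!: derivative_eq_intros simp flip: has_real_derivative_iff_has_vector_derivative)
  then have "((\<lambda>t. \<Phi> (t + \<sigma>) s) has_vector_derivative L (\<Phi> (t + \<sigma>) s)) (at t)" for t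
    using vector_diff_chain_at[of "\<lambda>t. t + \<sigma>" 1 t "\<lambda>t. \<Phi> t s" "L (\<Phi> (t + \<sigma>) s)"] deriv[of s "t + \<sigma>"]
    by (simp add: o_def)
  from unique[OF this, of \<tau>] show "\<Phi> (\<tau> + \<sigma>) s = (\<Phi> \<tau> \<circ> \<Phi> \<sigma>) s" by simp
qed

lemma has_derivative_fst:
  fixes p :: "real \<times> 'v"
  shows "((\<lambda>p. \<Phi> (fst p) u) has_derivative (\<lambda>q. fst q *\<^sub>R L (\<Phi> (fst p) u))) (at p)"
  using deriv[of u "fst p"]
    diff_chain_at[of fst fst p "\<lambda>t. \<Phi> t u" "\<lambda>h. h *\<^sub>R L (\<Phi> (fst p) u)"]
  by (simp add: has_vector_derivative_def o_def bounded_linear_imp_has_derivative bounded_linear_fst)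

lemma has_derivative:
  fixes p :: "real \<times> 'v"
  shows "((\<lambda>p. \<Phi> (fst p) (snd p)) has_derivative
    (\<lambda>q. fst q *\<^sub>R L (\<Phi> (fst p) (snd p)) + \<Phi> (fst p) (snd q))) (at p)"
proof -
  \<comment> \<open>Expansion in a basis separates the variables: \<open>\<Phi>\<close> becomes a
    finite sum of coordinates of the vector times curves in time, and the product rule yields the
    joint derivative.\<close>
  have expand: "\<Phi> t x = (\<Sum>b\<in>Basis. (x \<bullet> b) *\<^sub>R \<Phi> t b)" for t x
    by (subst euclidean_representation[of x, symmetric])
      (simp only: linear_sum[OF linear] linear_scale[OF linear])
  have "L (\<Phi> (fst p) (snd p)) = (\<Sum>b\<in>Basis. (snd p \<bullet> b) *\<^sub>R L (\<Phi> (fst p) b))"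
    by (subst expand) (simp add: linear_sum linear_scale bounded_linear.linear[OF bounded_linear])
  then have eq: "(\<Sum>b\<in>Basis. (snd p \<bullet> b) *\<^sub>R fst q *\<^sub>R L (\<Phi> (fst p) b) + (snd q \<bullet> b) *\<^sub>R \<Phi> (fst p) b)
      = fst q *\<^sub>R L (\<Phi> (fst p) (snd p)) + \<Phi> (fst p) (snd q)" for q :: "real \<times> 'v"
    by (subst expand[of "fst p" "snd q"])
      (simp add: sum.distrib scaleR_sum_right mult.commute)
  have "((\<lambda>p. \<Sum>b\<in>Basis. (snd p \<bullet> b) *\<^sub>R \<Phi> (fst p) b) has_derivative
      (\<lambda>q. \<Sum>b\<in>Basis. (snd p \<bullet> b) *\<^sub>R fst q *\<^sub>R L (\<Phi> (fst p) b) + (snd q \<bullet> b) *\<^sub>R \<Phi> (fst p) b)) (at p)"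
  proof (rule has_derivative_sum)
    fix b :: 'v
    have "((\<lambda>p. snd p \<bullet> b) has_derivative (\<lambda>q. snd q \<bullet> b)) (at p)"
      by (intro bounded_linear_imp_has_derivative
          bounded_linear_compose[OF bounded_linear_inner_left bounded_linear_snd])
    from has_derivative_scaleR[OF this has_derivative_fst]
    show "((\<lambda>p. (snd p \<bullet> b) *\<^sub>R \<Phi> (fst p) b) has_derivative
      (\<lambda>q. (snd p \<bullet> b) *\<^sub>R fst q *\<^sub>R L (\<Phi> (fst p) b) + (snd q \<bullet> b) *\<^sub>R \<Phi> (fst p) b)) (at p)" .
  qed
  then show ?thesis
    unfolding eq by (simp only: expand[symmetric])
qed

text \<open>
  The second conjunct makes the induction work: the derivative of \<open>(\<tau>, s) \<mapsto> \<Phi> \<tau> s\<close> in direction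
  \<open>(h, u)\<close> contains the term \<open>\<Phi> \<tau> u\<close>.
\<close>

lemma C_diff:
  "C_diff k (\<lambda>p. \<Phi> (fst p) (snd p)) \<and> (\<forall>u::'v. C_diff k (\<lambda>p::real \<times> 'v. \<Phi> (fst p) u))"
proof (induction k)
  case 0
  show ?case
    using has_derivative_continuous_on[OF has_derivative_at_withinI[OF has_derivative], of UNIV]
      has_derivative_continuous_on[OF has_derivative_at_withinI[OF has_derivative_fst], of UNIV]
    by simp
next
  case (Suc k)
  have scaled: "C_diff k (\<lambda>p. c *\<^sub>R L (f p))" if "C_diff k f" for c and f :: "real \<times> 'v \<Rightarrow> 'v"
    using C_diff_bounded_linear[OF bounded_linear_const_scaleR[OF bounded_linear] that] .
  have "C_diff (Suc k) (\<lambda>p. \<Phi> (fst p) (snd p))"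
    unfolding C_diff.simps
  proof (rule exI, intro conjI allI)
    show "((\<lambda>p. \<Phi> (fst p) (snd p)) has_derivative
      (\<lambda>q. fst q *\<^sub>R L (\<Phi> (fst p) (snd p)) + \<Phi> (fst p) (snd q))) (at p)" for p
      by (rule has_derivative)
    show "C_diff k (\<lambda>p. fst v *\<^sub>R L (\<Phi> (fst p) (snd p)) + \<Phi> (fst p) (snd v))" for v
      using Suc.IH by (intro C_diff_add scaled) blast+
  qed
  moreover have "C_diff (Suc k) (\<lambda>p::real \<times> 'v. \<Phi> (fst p) u)" for u
    unfolding C_diff.simps
  proof (rule exI, intro conjI allI)
    show "((\<lambda>p. \<Phi> (fst p) u) has_derivative (\<lambda>q. fst q *\<^sub>R L (\<Phi> (fst p) u))) (at p)"
      for p :: "real \<times> 'v"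
      by (rule has_derivative_fst)
    show "C_diff k (\<lambda>p::real \<times> 'v. fst v *\<^sub>R L (\<Phi> (fst p) u))" for v :: "real \<times> 'v"
      using Suc.IH by (intro scaled) blast
  qed
  ultimately show ?case by blast
qed

lemma smooth: "smooth (\<lambda>(\<tau>, s). \<Phi> \<tau> s)"
  by (simp add: smooth_def C_diff case_prod_unfold)

end


section \<open>Derivations and connections\<close>

text \<open>In finite dimension bilinearity implies boundedness. This supplies the product rule for
  curves of matrices and the continuity of one-sided multiplication.\<close>

interpretation matrix_mult: bounded_bilinear
  "(**) :: complex ^ 'n ^ 'm \<Rightarrow> complex ^ 'p ^ 'n \<Rightarrow> complex ^ 'p ^ 'm"
proof -
  have "bilinear ((**) :: complex ^ 'n ^ 'm \<Rightarrow> complex ^ 'p ^ 'n \<Rightarrow> _)"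
    by (auto simp: bilinear_def linear_iff matrix_add_ldistrib matrix_matrix_mult_def vec_eq_iff
        sum.distrib algebra_simps scaleR_sum_right)
  then show "bounded_bilinear ((**) :: complex ^ 'n ^ 'm \<Rightarrow> complex ^ 'p ^ 'n \<Rightarrow> _)"
    by (simp add: bilinear_conv_bounded_bilinear)
qed

lemma clinear_iff:
  "clinear f \<longleftrightarrow> (\<forall>x y. f (x + y) = f x + f y) \<and> (\<forall>c x. f (c *\<^sub>c x) = c *\<^sub>c f x)"
  by (simp add: Vector_Spaces.linear_iff vector_space_cscale)

lemma of_real_cscale: "of_real r *\<^sub>c M = r *\<^sub>R M"
  by (simp add: cscale_def vec_eq_iff scaleR_conv_of_real[where 'a = complex])

lemma cscale_add: "c *\<^sub>c (M + N) = c *\<^sub>c M + c *\<^sub>c N"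
  by (simp add: cscale_def vec_eq_iff algebra_simps)

lemma cscale_diff: "c *\<^sub>c (M - N) = c *\<^sub>c M - c *\<^sub>c N"
  by (simp add: cscale_def vec_eq_iff algebra_simps)

lemma cscale_mult_left: "(c *\<^sub>c M) ** N = c *\<^sub>c (M ** N)"
  by (simp add: cscale_def vec_eq_iff matrix_matrix_mult_def sum_distrib_left mult_ac)

lemma cscale_mult_right: "M ** (c *\<^sub>c N) = c *\<^sub>c (M ** N)"
  by (simp add: cscale_def vec_eq_iff matrix_matrix_mult_def sum_distrib_left mult_ac)

text \<open>Real scalars are complex ones, and real linear maps in finite dimension are bounded;
  this allows a derivation to be the generator of a \<open>linear_flow\<close>.\<close>

lemma clinear_imp_bounded_linear:
  assumes "clinear f"
  shows "bounded_linear f"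
  using assms unfolding clinear_iff linear_conv_bounded_linear[symmetric]
  by (intro linearI) (auto simp flip: of_real_cscale)

text \<open>The outer product of \<open>v\<close> with the \<open>k\<close>-th unit row. For fixed
  \<open>k\<close> these matrices are a copy of the column vectors, stable under multiplication from
  the left.\<close>

definition column_matrix :: "'n \<Rightarrow> complex ^ 'm \<Rightarrow> complex ^ 'n ^ 'm"
  where "column_matrix k v = (\<chi> i j. if j = k then v $ i else 0)"

lemma column_column_matrix [simp]: "column k (column_matrix k v) = v"
  by (simp add: column_def column_matrix_def vec_eq_iff)

lemma matrix_mult_column_matrix: "M ** column_matrix k v = column_matrix k (M *v v)"
  by (simp add: column_matrix_def vec_eq_iff matrix_matrix_mult_def matrix_vector_mult_def)

lemma column_mult: "column k (M ** N) = M *v column k N"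
  by (simp add: column_def vec_eq_iff matrix_matrix_mult_def matrix_vector_mult_def)

lemma column_add: "column k (M + N) = column k M + column k N"
  by (simp add: column_def vec_eq_iff)

lemma column_matrix_mult_vec: "column_matrix k v *v w = (w $ k) *s v"
proof -
  have "(if j = k then v $ i else 0) * w $ j = (if j = k then v $ i * w $ k else 0)" for i j
    by simp
  then show ?thesis
    by (simp add: column_matrix_def vec_eq_iff matrix_vector_mult_def mult.commute)
qed

text \<open>Embedding as a column, \<open>F\<close> and reading off a column are all linear. Both
  the matrix implementing a derivation and the gauge potential are obtained in this way.\<close>

lemma clinear_column_representation:
  fixes F :: "complex ^ 'n ^ 'm \<Rightarrow> complex ^ 'p ^ 'l"
  assumes "clinear F"
  shows "\<exists>M. \<forall>v. M *v v = column j (F (column_matrix k v))"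
proof -
  have "Vector_Spaces.linear (*s) (*s) (\<lambda>v. column j (F (column_matrix k v)))"
  proof (rule Vector_Spaces.linear_iff[THEN iffD2], intro conjI allI vec.vector_space_axioms)
    fix v w :: "complex ^ 'm" and c
    have "column_matrix k (v + w) = column_matrix k v + (column_matrix k w :: complex ^ 'n ^ 'm)"
      and "column_matrix k (c *s v) = c *\<^sub>c (column_matrix k v :: complex ^ 'n ^ 'm)"
      by (simp_all add: column_matrix_def cscale_def vec_eq_iff)
    then show "column j (F (column_matrix k (v + w))) = column j (F (column_matrix k v)) + column j (F (column_matrix k w))"
      and "column j (F (column_matrix k (c *s v))) = c *s column j (F (column_matrix k v))"
      using assms by (simp_all add: clinear_iff column_add) (simp add: column_def cscale_def vec_eq_iff)
  qed
  then show ?thesis using matrix_works by blast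
qed

lemma matrix_mult_left_cancel:
  fixes M N :: "complex ^ 'm ^ 'l"
  assumes "\<And>s::complex ^ 'n ^ 'm. M ** s = N ** s"
  shows "M = N"
proof -
  \<comment> \<open>One column suffices as a test; index types are nonempty, so
    \<open>undefined\<close> names some column.\<close>
  have "M *v v = N *v v" for v
    using arg_cong[OF assms[of "column_matrix undefined v"], of "column undefined"]
    by (simp add: column_mult)
  then show ?thesis by (simp add: matrix_eq)
qed

lemma mat_mult: "mat c ** M = c *\<^sub>c M" and mult_mat: "M ** mat c = c *\<^sub>c M"
proof -
  have "mat c = c *\<^sub>c mat 1"
    by (simp add: mat_def cscale_def vec_eq_iff)
  then show "mat c ** M = c *\<^sub>c M" "M ** mat c = c *\<^sub>c M"
    by (metis cscale_mult_left matrix_mul_lid, metis cscale_mult_right matrix_mul_rid)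
qed

section \<open>Inner derivations and the map \<open>theta\<close>\<close>

lemma trace_mat: "trace (mat c :: complex ^ 'n ^ 'n) = of_nat CARD('n) * c"
  by (simp add: trace_def mat_def)

text \<open>The Leibniz rule for \<open>a ** column_matrix k v\<close>, read in column
  \<open>k\<close>, says \<open>\<gamma> *v (a *v v) = X a *v v + a *v (\<gamma> *v v)\<close>,
  which is the commutator formula.\<close>

lemma Der_inner:
  fixes X :: "complex ^ 'n ^ 'n \<Rightarrow> complex ^ 'n ^ 'n"
  assumes "X \<in> Der"
  shows "\<exists>\<gamma>. trace \<gamma> = 0 \<and> (\<forall>a. X a = \<gamma> ** a - a ** \<gamma>)"
proof -
  define k :: 'n where "k = undefined"
  from assms have "clinear X" and leibniz: "\<And>a b. X (a ** b) = X a ** b + a ** X b"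
    by (auto simp: Der_def)
  then obtain \<gamma> where \<gamma>: "\<And>v. \<gamma> *v v = column k (X (column_matrix k v))"
    using clinear_column_representation by metis
  have "(\<gamma> ** a) *v v = (X a + a ** \<gamma>) *v v" for a v
  proof -
    have "(\<gamma> ** a) *v v = column k (X (a ** column_matrix k v))"
      by (simp add: \<gamma> matrix_mult_column_matrix flip: matrix_vector_mul_assoc)
    also have "\<dots> = (X a + a ** \<gamma>) *v v"
      by (simp add: leibniz column_add column_mult \<gamma> matrix_vector_mult_add_rdistrib
          flip: matrix_vector_mul_assoc)
    finally show ?thesis .
  qed
  then have inner: "X a = \<gamma> ** a - a ** \<gamma>" for a
    by (metis matrix_eq add_diff_cancel_right')
  \<comment> \<open>Subtracting a scalar matrix does not change commutators; this scalar makes the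
    trace vanish.\<close>
  define c where "c = trace \<gamma> / of_nat CARD('n)"
  have "trace (\<gamma> - mat c) = 0"
    by (simp add: trace_sub trace_mat c_def)
  moreover have "X a = (\<gamma> - mat c) ** a - a ** (\<gamma> - mat c)" for a
    by (simp add: inner matrix_mult.diff_left matrix_mult.diff_right mat_mult mult_mat)
  ultimately show ?thesis by blast
qed

text \<open>Commuting with every \<open>column_matrix k v\<close> forces \<open>\<gamma>\<close> to
  be scalar: column \<open>k\<close> of the two products gives \<open>\<gamma> *v v\<close> and the
  \<open>k\<close>-th diagonal entry times \<open>v\<close>. The trace is that entry times the
  positive dimension.\<close>

lemma central_traceless_eq_0:
  fixes \<gamma> :: "complex ^ 'n ^ 'n"
  assumes comm: "\<And>a. \<gamma> ** a = a ** \<gamma>" and tr: "trace \<gamma> = 0"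
  shows "\<gamma> = 0"
proof -
  define k :: 'n where "k = undefined"
  define c where "c = column k \<gamma> $ k"
  have "\<gamma> *v v = mat c *v v" for v
  proof -
    have "\<gamma> *v v = column k (column_matrix k v ** \<gamma>)"
      by (simp add: column_mult flip: comm)
    also have "\<dots> = c *s v"
      by (simp add: column_mult column_matrix_mult_vec c_def)
    also have "\<dots> = mat c *v v"
      by (simp add: vec_eq_iff mat_def matrix_vector_mult_def if_distrib[of "\<lambda>x. x * _"] cong: if_cong)
    finally show ?thesis .
  qed
  then have "\<gamma> = mat c" by (simp add: matrix_eq)
  with tr show ?thesis by (simp add: trace_mat)
qed

text \<open>Two traceless matrices implementing \<open>X\<close> differ by a traceless central
  matrix, which is zero.\<close>

lemma theta_eqI:
  assumes "trace \<gamma> = 0" "\<And>a. X a = \<gamma> ** a - a ** \<gamma>"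
  shows "theta X = \<gamma>"
  unfolding theta_def
proof (rule the_equality)
  fix \<delta>
  assume \<delta>: "trace \<delta> = 0 \<and> (\<forall>a. X a = \<delta> ** a - a ** \<delta>)"
  have eq: "\<delta> ** a - a ** \<delta> = \<gamma> ** a - a ** \<gamma>" for a
    using \<delta> assms(2)[of a] by metis
  have "(\<delta> - \<gamma>) ** a = a ** (\<delta> - \<gamma>)" for a
    using eq[of a] by (simp add: matrix_mult.diff_left matrix_mult.diff_right algebra_simps)
  moreover have "trace (\<delta> - \<gamma>) = 0"
    using \<delta> assms(1) by (simp add: trace_sub)
  ultimately show "\<delta> = \<gamma>"
    using central_traceless_eq_0[of "\<delta> - \<gamma>"] by simp
qed (use assms in simp)

lemma
  assumes "X \<in> Der"
  shows trace_theta: "trace (theta X) = 0"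
    and theta_commutator: "X a = theta X ** a - a ** theta X"
proof -
  obtain \<gamma> where "trace \<gamma> = 0" "\<And>a. X a = \<gamma> ** a - a ** \<gamma>"
    using Der_inner[OF assms] by blast
  with theta_eqI[of \<gamma> X] show "trace (theta X) = 0" "X a = theta X ** a - a ** theta X"
    by metis+
qed

text \<open>Together with \<open>theta_cscale\<close> this is the linearity of \<open>theta\<close>,
  from which the gauge potential inherits its own.\<close>

lemma theta_add:
  assumes "X \<in> Der" "Y \<in> Der"
  shows "theta (\<lambda>a. X a + Y a) = theta X + theta Y"
  by (rule theta_eqI)
    (simp_all add: trace_add trace_theta theta_commutator assms matrix_mult.add_left matrix_mult.add_right)

lemma theta_cscale:
  assumes "X \<in> Der"
  shows "theta (\<lambda>a. c *\<^sub>c X a) = c *\<^sub>c theta X"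
proof (rule theta_eqI)
  have "trace (c *\<^sub>c theta X) = c * trace (theta X)"
    by (simp add: trace_def cscale_def sum_distrib_left)
  then show "trace (c *\<^sub>c theta X) = 0" by (simp add: trace_theta assms)
  show "c *\<^sub>c X a = (c *\<^sub>c theta X) ** a - a ** (c *\<^sub>c theta X)" for a
    by (simp add: theta_commutator[OF assms, of a] cscale_diff cscale_mult_left cscale_mult_right)
qed

section \<open>Connections and gauge potentials\<close>

lemma right_module_hom_eq_left_mult:
  fixes F :: "complex ^ 'n ^ 'm \<Rightarrow> complex ^ 'n ^ 'l"
  assumes "clinear F" and hom: "\<And>s a. F (s ** a) = F s ** a"
  shows "\<exists>M. \<forall>s. F s = M ** s"
proof -
  define k :: 'n where "k = undefined"
  obtain M where M: "\<And>v. M *v v = column k (F (column_matrix k v))"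
    using clinear_column_representation[OF assms(1)] by metis
  have "F s *v v = (M ** s) *v v" for s v
  proof -
    \<comment> \<open>Right linearity moves the test matrix inside \<open>F\<close>, where
      \<open>s ** column_matrix k v\<close> is the column matrix of \<open>s *v v\<close>.\<close>
    have "F s *v v = column k (F (s ** column_matrix k v))"
      by (simp add: hom column_mult)
    also have "\<dots> = (M ** s) *v v"
      by (simp add: M matrix_mult_column_matrix flip: matrix_vector_mul_assoc)
    finally show ?thesis .
  qed
  then show ?thesis by (metis matrix_eq)
qed

lemma connection_eq_canonical_plus_left_mult:
  fixes D :: "(complex ^ 'n ^ 'n \<Rightarrow> complex ^ 'n ^ 'n) \<Rightarrow> complex ^ 'n ^ 'm \<Rightarrow> complex ^ 'n ^ 'm"
  assumes "connection \<gg> D" "X \<in> \<gg>" "X \<in> Der"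
  shows "\<exists>M. \<forall>s. D X s = canonical_connection X s + M ** s"
proof -
  define F where "F s = D X s + s ** theta X" for s
  have lin: "clinear (D X)" and leibniz: "\<And>s a. D X (s ** a) = D X s ** a + s ** X a"
    using assms by (auto simp: connection_def)
  have "clinear F"
    using lin unfolding clinear_iff F_def
    by (simp add: cscale_add cscale_mult_left matrix_mult.add_left)
  \<comment> \<open>The Leibniz term \<open>s ** X a\<close> is
    \<open>s ** theta X ** a - s ** a ** theta X\<close>; its second part cancels the term added in
    \<open>F\<close>.\<close>
  moreover have "F (s ** a) = F s ** a" for s a
    by (simp add: F_def leibniz theta_commutator[OF assms(3), of a] matrix_mult.add_left
        matrix_mult.diff_right matrix_mul_assoc)
  ultimately obtain M where "\<And>s. F s = M ** s"
    using right_module_hom_eq_left_mult by metis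
  then have "D X s = canonical_connection X s + M ** s" for s
    by (metis F_def canonical_connection_def add_diff_cancel_right' uminus_add_conv_diff)
  then show ?thesis by blast
qed

lemma gauge_potential:
  fixes D :: "(complex ^ 'n ^ 'n \<Rightarrow> complex ^ 'n ^ 'n) \<Rightarrow> complex ^ 'n ^ 'm \<Rightarrow> complex ^ 'n ^ 'm"
  assumes \<gg>: "lie_subalgebra_Der \<gg>" and D: "connection \<gg> D" and "X \<in> \<gg>"
  shows "D X s = canonical_connection X s + gauge_potential \<gg> D X ** s"
proof -
  have Der: "X \<in> Der" if "X \<in> \<gg>" for X
    using \<gg> that by (auto simp: lie_subalgebra_Der_def)
  have closed: "\<And>X Y. X \<in> \<gg> \<Longrightarrow> Y \<in> \<gg> \<Longrightarrow> (\<lambda>a. X a + Y a) \<in> \<gg>"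
      "\<And>X c. X \<in> \<gg> \<Longrightarrow> (\<lambda>a. c *\<^sub>c X a) \<in> \<gg>"
    using \<gg> by (auto simp: lie_subalgebra_Der_def)
  have D_add: "\<And>X Y s. X \<in> \<gg> \<Longrightarrow> Y \<in> \<gg> \<Longrightarrow> D (\<lambda>a. X a + Y a) s = D X s + D Y s"
    and D_scale: "\<And>X c s. X \<in> \<gg> \<Longrightarrow> D (\<lambda>a. c *\<^sub>c X a) s = c *\<^sub>c D X s"
    using D by (auto simp: connection_def clinear_on_Der_def)
  \<comment> \<open>\<open>B\<close> is chosen separately for each \<open>X\<close>; its linearity
    is recovered afterwards from that of \<open>D\<close> and \<open>theta\<close>, since a matrix
    is determined by its left multiplication.\<close>
  obtain B where B: "\<And>X s. X \<in> \<gg> \<Longrightarrow> D X s = canonical_connection X s + B X ** s"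
    using connection_eq_canonical_plus_left_mult[OF D _ Der] by metis
  have B_mult: "B X ** s = D X s + s ** theta X" if "X \<in> \<gg>" for X s
    using B[OF that, of s] by (simp add: canonical_connection_def)
  have B_add: "B (\<lambda>a. X a + Y a) = B X + B Y" if "X \<in> \<gg>" "Y \<in> \<gg>" for X Y
    by (rule matrix_mult_left_cancel[where 'n = 'n])
      (simp add: B_mult D_add theta_add Der closed that matrix_mult.add_left matrix_mult.add_right)
  have B_scale: "B (\<lambda>a. c *\<^sub>c X a) = c *\<^sub>c B X" if "X \<in> \<gg>" for X c
    by (rule matrix_mult_left_cancel[where 'n = 'n])
      (simp add: B_mult D_scale theta_cscale Der closed that cscale_mult_left cscale_mult_right cscale_add)
  have "\<exists>!B. B \<in> extensional \<gg> \<and> clinear_on_Der \<gg> B \<and>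
    (\<forall>X\<in>\<gg>. \<forall>s. D X s = canonical_connection X s + B X ** s)"
  \<comment> \<open>Restriction fixes the arbitrary values off \<open>\<gg>\<close>, so that
    uniqueness on \<open>\<gg>\<close> becomes equality of functions.\<close>
  proof (rule ex1I[of _ "restrict B \<gg>"])
    show "restrict B \<gg> \<in> extensional \<gg> \<and> clinear_on_Der \<gg> (restrict B \<gg>) \<and>
      (\<forall>X\<in>\<gg>. \<forall>s. D X s = canonical_connection X s + restrict B \<gg> X ** s)"
      using B by (auto simp: clinear_on_Der_def B_add B_scale closed)
  next
    fix C
    assume C: "C \<in> extensional \<gg> \<and> clinear_on_Der \<gg> C \<and>
      (\<forall>X\<in>\<gg>. \<forall>s. D X s = canonical_connection X s + C X ** s)"
    show "C = restrict B \<gg>"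
    proof (rule extensionalityI[of _ \<gg>])
      fix X
      assume X: "X \<in> \<gg>"
      have "C X ** s = B X ** s" for s :: "complex ^ 'n ^ 'm"
        using C X B[OF X, of s] by (metis add_left_cancel)
      from matrix_mult_left_cancel[OF this] X show "C X = restrict B \<gg> X" by simp
    qed (use C in auto)
  qed
  from theI'[OF this] \<open>X \<in> \<gg>\<close> show ?thesis
    unfolding gauge_potential_def by blast
qed

section \<open>The matrix exponential and parallel transport\<close>

text \<open>\<open>mexp\<close> is \<open>opexp\<close> of left multiplication by the matrix,
  applied to the identity matrix.\<close>

lemma mexp_has_vector_derivative:
  "((\<lambda>t. mexp (t *\<^sub>R M)) has_vector_derivative M ** mexp (t *\<^sub>R M)) (at t)"
proof -
  have "mexp (t *\<^sub>R M) = opexp (\<lambda>x. t *\<^sub>R (M ** x)) (mat 1)" for t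
    by (simp add: mexp_def opexp_def matrix_mult.scaleR_left[abs_def])
  then show ?thesis
    using opexp_has_vector_derivative[OF matrix_mult.bounded_linear_right, of M "mat 1" t]
    by simp
qed

lemma mexp_zero [simp]: "mexp 0 = mat 1"
proof -
  have "mexp 0 = opexp (\<lambda>x. 0) (mat 1)"
    by (simp add: mexp_def opexp_def matrix_mult.zero_left[abs_def])
  then show ?thesis by (simp add: opexp_zero)
qed

text \<open>Both sides solve \<open>Y' = M ** Y\<close> with the value \<open>M\<close> at time
  0.\<close>

lemma mexp_commute: "mexp (t *\<^sub>R M) ** M = M ** mexp (t *\<^sub>R M)"
proof (rule linear_ode_unique[where L = "(**) M" and t = t])
  show "((\<lambda>t. mexp (t *\<^sub>R M) ** M) has_vector_derivative M ** (mexp (t *\<^sub>R M) ** M)) (at t)" for t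
    using bounded_linear.has_vector_derivative[OF matrix_mult.bounded_linear_left mexp_has_vector_derivative]
    by (simp add: matrix_mul_assoc)
  show "((\<lambda>t. M ** mexp (t *\<^sub>R M)) has_vector_derivative M ** (M ** mexp (t *\<^sub>R M))) (at t)" for t
    by (rule bounded_linear.has_vector_derivative[OF matrix_mult.bounded_linear_right mexp_has_vector_derivative])
qed (simp_all add: matrix_mult.bounded_linear_right)

lemma linear_flow_mexp:
  fixes M :: "complex ^ 'm ^ 'm" and N :: "complex ^ 'n ^ 'n"
  assumes "\<And>s. L s = M ** s - s ** N"
  shows "linear_flow L (\<lambda>\<tau> s. mexp (\<tau> *\<^sub>R M) ** s ** mexp (- (\<tau> *\<^sub>R N)))"
proof (rule linear_flow.intro)
  have "L = (\<lambda>s. M ** s - s ** N)"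
    using assms by (rule ext)
  then show "bounded_linear L"
    by (auto intro!: bounded_linear_sub matrix_mult.bounded_linear_left matrix_mult.bounded_linear_right)
  fix \<tau> and s :: "complex ^ 'n ^ 'm"
  have left: "((\<lambda>t. mexp (t *\<^sub>R M) ** s) has_vector_derivative M ** mexp (\<tau> *\<^sub>R M) ** s) (at \<tau>)"
    by (rule bounded_linear.has_vector_derivative[OF matrix_mult.bounded_linear_left mexp_has_vector_derivative])
  \<comment> \<open>The derivative of the exponential carries \<open>- N\<close> on the left;
    \<open>mexp_commute\<close> moves it to the far right, where \<open>L\<close> has it.\<close>
  have right: "((\<lambda>t. mexp (- (t *\<^sub>R N))) has_vector_derivative - (mexp (- (\<tau> *\<^sub>R N)) ** N)) (at \<tau>)"
    using mexp_has_vector_derivative[of "- N" \<tau>] mexp_commute[of \<tau> "- N"]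
    by (simp add: matrix_mult.minus_left matrix_mult.minus_right)
  show "((\<lambda>t. mexp (t *\<^sub>R M) ** s ** mexp (- (t *\<^sub>R N))) has_vector_derivative
      L (mexp (\<tau> *\<^sub>R M) ** s ** mexp (- (\<tau> *\<^sub>R N)))) (at \<tau>)"
    using matrix_mult.has_vector_derivative[OF left right]
    by (simp add: assms matrix_mult.minus_right matrix_mul_assoc)
qed simp

text \<open>By the product rule and the Leibniz rule the right-hand side is a solution curve of
  \<open>L\<close> starting at \<open>s ** a\<close>.\<close>

lemma linear_flow_leibniz:
  fixes L :: "complex ^ 'n ^ 'm \<Rightarrow> complex ^ 'n ^ 'm"
  assumes \<Phi>: "linear_flow L \<Phi>" and \<phi>: "linear_flow X \<phi>"
    and leibniz: "\<And>s a. L (s ** a) = L s ** a + s ** X a"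
  shows "\<Phi> \<tau> (s ** a) = \<Phi> \<tau> s ** \<phi> \<tau> a"
proof -
  have "((\<lambda>t. \<Phi> t s ** \<phi> t a) has_vector_derivative L (\<Phi> t s ** \<phi> t a)) (at t)" for t
    using matrix_mult.has_vector_derivative[OF linear_flow.deriv[OF \<Phi>] linear_flow.deriv[OF \<phi>]]
    by (simp add: leibniz add.commute)
  from linear_flow.unique[OF \<Phi> this, of \<tau>] show ?thesis
    by (simp add: linear_flow.at_0[OF \<Phi>] linear_flow.at_0[OF \<phi>])
qed

section \<open>The flow of a derivation and parallel transport along it\<close>

lemma linear_flow_flow:
  assumes "X \<in> Der"
  shows "linear_flow X (flow X)"
proof (rule linear_flow.intro)
  show *: "bounded_linear X"
    using assms by (simp add: Der_def clinear_imp_bounded_linear)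
  show "((\<lambda>t. flow X t s) has_vector_derivative X (flow X \<tau> s)) (at \<tau>)" for \<tau> s
    unfolding flow_def by (rule opexp_has_vector_derivative[OF *])
qed (simp add: flow_def opexp_zero)

lemma one_parameter_group_flow:
  assumes "X \<in> Der"
  shows "one_parameter_group (flow X)"
proof -
  interpret linear_flow X "flow X" by (rule linear_flow_flow[OF assms])
  \<comment> \<open>Here \<open>A\<close> is viewed as a right module over itself and
    \<open>X\<close> takes both roles in the Leibniz rule.\<close>
  have "flow X \<tau> (a ** b) = flow X \<tau> a ** flow X \<tau> b" for \<tau> a b
    by (rule linear_flow_leibniz) (use assms linear_flow_axioms in \<open>auto simp: Der_def\<close>)
  then show ?thesis
    unfolding one_parameter_group_def using smooth group_law by (auto simp: at_0)
qed

text \<open>The equation and the value at time 0 force \<open>\<Phi>'\<close> to be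
  \<open>\<Phi>\<close>; conversely a linear flow has all the required properties. The equivalence
  yields existence, uniqueness and the formula at once.\<close>

lemma parallel_transport_of_linear_flow:
  assumes \<Phi>: "linear_flow (D X) \<Phi>" and X: "X \<in> Der"
    and leibniz: "\<And>s a. D X (s ** a) = D X s ** a + s ** X a"
  shows "parallel_transport_of D X \<Phi>' \<longleftrightarrow> \<Phi>' = \<Phi>"
proof
  interpret linear_flow "D X" \<Phi> by fact
  show "\<Phi>' = \<Phi>" if "parallel_transport_of D X \<Phi>'"
  proof (intro ext)
    fix \<tau> s
    have "\<Phi>' \<tau> s = \<Phi> \<tau> (\<Phi>' 0 s)"
      by (rule unique) (use that in \<open>simp add: parallel_transport_of_def\<close>)
    then show "\<Phi>' \<tau> s = \<Phi> \<tau> s"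
      using that by (simp add: parallel_transport_of_def module_parallel_transport_def)
  qed
  have "\<Phi> \<tau> (s ** a) = \<Phi> \<tau> s ** flow X \<tau> a" for \<tau> s a
    by (rule linear_flow_leibniz[OF \<Phi> linear_flow_flow[OF X] leibniz])
  then show "parallel_transport_of D X \<Phi>'" if "\<Phi>' = \<Phi>"
    unfolding that parallel_transport_of_def module_parallel_transport_def
    using one_parameter_group_flow[OF X] smooth group_law deriv by (auto simp: at_0)
qed

theorem proposition3p4:
  fixes \<gg> :: "(complex ^ 'n ^ 'n \<Rightarrow> complex ^ 'n ^ 'n) set"
    and D :: "(complex ^ 'n ^ 'n \<Rightarrow> complex ^ 'n ^ 'n) \<Rightarrow> complex ^ 'n ^ 'm \<Rightarrow> complex ^ 'n ^ 'm"
  assumes "lie_subalgebra_Der \<gg>"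
    and "connection \<gg> D"
  shows "\<forall>X\<in>\<gg>.
    (\<exists>!\<Phi>. parallel_transport_of D X \<Phi>) \<and>
    (\<forall>\<Phi>. parallel_transport_of D X \<Phi> \<longrightarrow>
      (\<forall>s \<tau>. \<Phi> \<tau> s =
        mexp (\<tau> *\<^sub>R gauge_potential \<gg> D X) ** s ** mexp (- (\<tau> *\<^sub>R theta X))))"
proof
  fix X
  assume X: "X \<in> \<gg>"
  then have "X \<in> Der"
    using assms(1) by (auto simp: lie_subalgebra_Der_def)
  moreover have "D X (s ** a) = D X s ** a + s ** X a" for s a
    using assms(2) X by (simp add: connection_def)
  \<comment> \<open>The closed formula serves as the witness: relative to the canonical connection,
    \<open>D X\<close> is \<open>s \<mapsto> M ** s - s ** N\<close> with \<open>M\<close> the gauge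
    potential and \<open>N\<close> the matrix \<open>theta X\<close>.\<close>
  moreover have "linear_flow (D X)
      (\<lambda>\<tau> s. mexp (\<tau> *\<^sub>R gauge_potential \<gg> D X) ** s ** mexp (- (\<tau> *\<^sub>R theta X)))"
    by (rule linear_flow_mexp) (simp add: gauge_potential[OF assms X] canonical_connection_def)
  ultimately show "(\<exists>!\<Phi>. parallel_transport_of D X \<Phi>) \<and>
    (\<forall>\<Phi>. parallel_transport_of D X \<Phi> \<longrightarrow>
      (\<forall>s \<tau>. \<Phi> \<tau> s =
        mexp (\<tau> *\<^sub>R gauge_potential \<gg> D X) ** s ** mexp (- (\<tau> *\<^sub>R theta X))))"
    by (simp add: parallel_transport_of_linear_flow)
qed

end
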